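(* Let $\beta\in[0,1]$ and let $x\in\mathbb{C}$ with $|x|\leq1$, $x\neq1$. If $f\in\mathcal{A}_\beta$, then the function $$ z\mapsto\int_0^z\frac{f(t)-f(xt)}{t-xt}\,dt $$ belongs to $\mathcal{A}_\beta$.
   Context: $\mathbb{D}=\{z\in\mathbb{C}:|z|<1\}$. $\mathcal{A}$ is the class of functions $f$ holomorphic in $\mathbb{D}$ with $f(0)=0$ and $f'(0)=1$. For $\beta\in[0,1]$, $$\mathcal{A}_\beta=\left\{f\in\mathcal{A}:\operatorname{Re}\left(\beta\frac{f(z)}{z}+(1-\beta)f'(z)\right)>0 \text{ for all } z\in\mathbb{D}\right\},$$ where $f(z)/z$ is given the value $1$ at $z=0$. The removable singularity of the integrand at $t=0$ is removed. *)

theory Defs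
  imports "HOL-Complex_Analysis.Complex_Analysis"
begin

text \<open>
  Functions on the unit disc are represented by total functions on the complex numbers;
  their values outside the disc are irrelevant to all the notions below.
\<close>

abbreviation unit_disc :: "complex set" where
  "unit_disc \<equiv> ball 0 1"

definition class_A :: "(complex \<Rightarrow> complex) set" where
  "class_A = {f. f holomorphic_on unit_disc \<and> f 0 = 0 \<and> deriv f 0 = 1}"

definition class_A_beta :: "real \<Rightarrow> (complex \<Rightarrow> complex) set" where
  "class_A_beta \<beta> =
     {f \<in> class_A. \<forall>z\<in>unit_disc.
        Re (of_real \<beta> * (if z = 0 then 1 else f z / z) + of_real (1 - \<beta>) * deriv f z) > 0}"

text \<open>
  The integral from \<open>0\<close> to \<open>z\<close> is taken along the straight segment. For \<open>f\<close> holomorphic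
  in the disc, \<open>x \<noteq> 1\<close> and \<open>norm x \<le> 1\<close>, the integrand extends holomorphically to the disc,
  so any other path in the disc gives the same value.
\<close>

definition diff_quot_integral :: "complex \<Rightarrow> (complex \<Rightarrow> complex) \<Rightarrow> complex \<Rightarrow> complex" where
  "diff_quot_integral x f z =
     contour_integral (linepath 0 z) (remove_sings (\<lambda>t. (f t - f (x * t)) / (t - x * t)))"

end

theory Submission
  imports Defs
begin

text \<open>
  Write \<open>\<phi>(z) = f(z)/z\<close> (with \<open>\<phi>(0) = 1\<close>) and let \<open>\<Phi>\<close> be a primitive of \<open>\<phi>\<close> in the disc.
  The function \<open>F(z) = (\<Phi>(z) - \<Phi>(xz))/(1 - x)\<close> vanishes at \<open>0\<close> and has the derivative
  \<open>(\<phi>(z) - x \<phi>(xz))/(1 - x) = (f(z) - f(xz))/(z - xz)\<close>, so it is the integral in question.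
  Hence both \<open>F(z)/z\<close> and \<open>F'(z)\<close> are difference quotients between \<open>xz\<close> and \<open>z\<close>, the first
  of \<open>\<Phi>\<close> and the second of \<open>f\<close>, and

  \<open>\<beta> F(z)/z + (1 - \<beta>) F'(z) = (P(z) - P(xz))/(z - xz)\<close>  where  \<open>P = \<beta> \<Phi> + (1 - \<beta>) f\<close>

  for \<open>z \<noteq> 0\<close>; at the origin the left-hand side is read as \<open>\<beta> + (1 - \<beta>) F'(0) = 1\<close>.

  Now \<open>P' = \<beta> \<phi> + (1 - \<beta>) f'\<close> has positive real part in the disc exactly because \<open>f\<close> lies in the
  class, and on a convex set a function whose derivative has positive real part has difference
  quotients with positive real part (\<open>Re_difference_quotient_pos\<close>, the argument behind the
  Noshiro-Warschawski univalence criterion).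
\<close>

text \<open>
  The mean value theorem fails for complex functions, but it holds for the real part along a
  segment; dividing \<open>P\<close> by \<open>a - b\<close> first turns the increment into the difference quotient.
\<close>
lemma Re_difference_quotient_pos:
  fixes P P' :: "complex \<Rightarrow> complex"
  assumes "convex S" "a \<in> S" "b \<in> S" "a \<noteq> b"
    and deriv: "\<And>z. z \<in> S \<Longrightarrow> (P has_field_derivative P' z) (at z)"
    and pos: "\<And>z. z \<in> S \<Longrightarrow> Re (P' z) > 0"
  shows "Re ((P a - P b) / (a - b)) > 0"
proof -
  have seg: "closed_segment b a \<subseteq> S"
    using assms(1-3) by (simp add: closed_segment_subset)
  have "((\<lambda>w. P w / (a - b)) has_field_derivative P' u / (a - b)) (at u)"
    if "u \<in> closed_segment b a" for u
    using deriv[of u] that seg by (intro DERIV_cdivide) auto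
  then obtain u where u: "u \<in> closed_segment b a"
    and eq: "Re (P a / (a - b)) - Re (P b / (a - b)) = Re (P' u / (a - b) * (a - b))"
    using complex_mvt_line[of b a "\<lambda>w. P w / (a - b)" "\<lambda>u. P' u / (a - b)"] by blast
  have "Re ((P a - P b) / (a - b)) = Re (P' u)"
    using eq \<open>a \<noteq> b\<close> by (simp add: diff_divide_distrib)
  then show ?thesis
    using pos u seg by auto
qed

lemma quotient_by_id_holomorphic:
  assumes "f holomorphic_on S" "open S" "f 0 = 0"
  shows "(\<lambda>z. if z = 0 then deriv f 0 else f z / z) holomorphic_on S"
  by (rule pole_theorem_open_0[OF assms(1,2)]) (use assms(3) in auto)

lemma mult_in_unit_disc:
  fixes x z :: complex
  assumes "norm x \<le> 1" "z \<in> unit_disc"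
  shows "x * z \<in> unit_disc"
  using assms mult_right_mono[of "norm x" 1 "norm z"] by (simp add: norm_mult)

text \<open>
  At the origin the value is the limit of the difference quotient; away from it the integrand is
  already continuous, so one limit computation covers both cases.
\<close>
lemma remove_sings_difference_quotient:
  fixes f :: "complex \<Rightarrow> complex" and x z :: complex
  defines "\<phi> \<equiv> (\<lambda>z. if z = 0 then deriv f 0 else f z / z)"
  assumes f: "f holomorphic_on unit_disc" "f 0 = 0"
    and x: "norm x \<le> 1" "x \<noteq> 1" and z: "z \<in> unit_disc"
  shows "remove_sings (\<lambda>t. (f t - f (x * t)) / (t - x * t)) z
           = (\<phi> z - x * \<phi> (x * z)) / (1 - x)"
proof (rule remove_sings_eqI)
  let ?g = "\<lambda>t. (\<phi> t - x * \<phi> (x * t)) / (1 - x)"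
  have hol: "\<phi> holomorphic_on unit_disc"
    unfolding \<phi>_def using f by (intro quotient_by_id_holomorphic) auto
  have "(\<phi> \<circ> (*) x) holomorphic_on unit_disc"
    using hol mult_in_unit_disc[OF x(1)]
    by (intro holomorphic_on_compose_gen[where t = unit_disc] holomorphic_intros) auto
  then have "?g holomorphic_on unit_disc"
    using hol x(2) by (auto simp: o_def intro!: holomorphic_intros)
  then have "continuous_on unit_disc ?g"
    by (rule holomorphic_on_imp_continuous_on)
  then have "?g \<midarrow>z\<rightarrow> ?g z"
    using continuous_on_eq_continuous_at[OF open_ball] z unfolding isCont_def by fast
  moreover have "eventually (\<lambda>t. t \<noteq> 0) (at z)"
    by (rule eventually_neq_at_within)
  then have "eventually (\<lambda>t. ?g t = (f t - f (x * t)) / (t - x * t)) (at z)"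
  proof eventually_elim
    case (elim t)
    \<comment> \<open>For \<open>x = 0\<close> the second term is \<open>0\<close> on both sides, on the right because \<open>f 0 = 0\<close>.\<close>
    have "x * \<phi> (x * t) = f (x * t) / t"
      using elim f(2) by (simp add: \<phi>_def)
    moreover have "\<phi> t = f t / t"
      using elim by (simp add: \<phi>_def)
    ultimately have "?g t = (f t - f (x * t)) / (t * (1 - x))"
      by (simp add: diff_divide_distrib[symmetric])
    then show ?case
      by (simp add: algebra_simps)
  qed
  ultimately show "(\<lambda>t. (f t - f (x * t)) / (t - x * t)) \<midarrow>z\<rightarrow> ?g z"
    by (rule Lim_transform_eventually)
qed

text \<open>
  The integrand is \<open>f(t)/t - f(xt)/t\<close> up to the factor \<open>1/(1 - x)\<close>, and both terms are integrated
  by the same primitive: the factor \<open>x\<close> from the chain rule turns \<open>f(xt)/(xt)\<close> into \<open>f(xt)/t\<close>.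
\<close>
lemma diff_quot_integral_eq:
  fixes f :: "complex \<Rightarrow> complex" and x z :: complex
  defines "\<phi> \<equiv> (\<lambda>z. if z = 0 then deriv f 0 else f z / z)"
  assumes f: "f holomorphic_on unit_disc" "f 0 = 0"
    and x: "norm x \<le> 1" "x \<noteq> 1"
    and \<Phi>: "\<And>z. z \<in> unit_disc \<Longrightarrow> (\<Phi> has_field_derivative \<phi> z) (at z)"
    and z: "z \<in> unit_disc"
  shows "diff_quot_integral x f z = (\<Phi> z - \<Phi> (x * z)) / (1 - x)"
    and "(diff_quot_integral x f has_field_derivative (\<phi> z - x * \<phi> (x * z)) / (1 - x)) (at z)"
proof -
  define A where "A = (\<lambda>z. (\<Phi> z - \<Phi> (x * z)) / (1 - x))"
  define g where "g = (\<lambda>z. (\<phi> z - x * \<phi> (x * z)) / (1 - x))"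
  let ?q = "remove_sings (\<lambda>t. (f t - f (x * t)) / (t - x * t))"
  have A': "(A has_field_derivative g w) (at w)" if w: "w \<in> unit_disc" for w
    unfolding A_def g_def using x \<Phi>[OF w] \<Phi>[OF mult_in_unit_disc[OF x(1) w]]
    by (auto intro!: derivative_eq_intros DERIV_chain2[where f = \<Phi>])
  have q: "?q w = g w" if "w \<in> unit_disc" for w
    using remove_sings_difference_quotient[OF f x that] by (simp add: g_def \<phi>_def)
  have F: "diff_quot_integral x f w = A w" if w: "w \<in> unit_disc" for w
  proof -
    have seg: "closed_segment 0 w \<subseteq> unit_disc"
      using w by (intro closed_segment_subset) auto
    have "(g has_contour_integral A (pathfinish (linepath 0 w)) - A (pathstart (linepath 0 w)))
            (linepath 0 w)"
    proof (rule contour_integral_primitive)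
      show "(A has_field_derivative g v) (at v within unit_disc)" if "v \<in> unit_disc" for v
        using A'[OF that] by (rule has_field_derivative_at_within)
      show "path_image (linepath 0 w) \<subseteq> unit_disc"
        using seg by (simp only: path_image_linepath)
    qed (rule valid_path_linepath)
    then have "(g has_contour_integral A w - A 0) (linepath 0 w)"
      by (simp only: pathfinish_linepath pathstart_linepath)
    then have "(?q has_contour_integral A w - A 0) (linepath 0 w)"
      by (rule has_contour_integral_eq)
        (use q seg in \<open>simp only: path_image_linepath subset_eq\<close>)
    then show ?thesis
      by (simp add: diff_quot_integral_def contour_integral_unique A_def)
  qed
  show "diff_quot_integral x f z = (\<Phi> z - \<Phi> (x * z)) / (1 - x)"
    using F[OF z] by (simp add: A_def)
  show "(diff_quot_integral x f has_field_derivative (\<phi> z - x * \<phi> (x * z)) / (1 - x)) (at z)"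
    using has_field_derivative_transform_within_open[OF A'[OF z], of unit_disc] z F
    by (auto simp: g_def)
qed

theorem corollary2p9:
  fixes \<beta> :: real and x :: complex and f :: "complex \<Rightarrow> complex"
  assumes "\<beta> \<in> {0..1}"
    and "norm x \<le> 1" and "x \<noteq> 1"
    and "f \<in> class_A_beta \<beta>"
  shows "(\<lambda>z. diff_quot_integral x f z) \<in> class_A_beta \<beta>"
proof -
  define \<phi> where "\<phi> = (\<lambda>z. if z = 0 then deriv f 0 else f z / z)"
  define F where "F = diff_quot_integral x f"
  have f: "f holomorphic_on unit_disc" "f 0 = 0" "deriv f 0 = 1"
    and pos: "\<And>z. z \<in> unit_disc \<Longrightarrow> Re (of_real \<beta> * \<phi> z + of_real (1 - \<beta>) * deriv f z) > 0"
    using assms(4) by (auto simp: class_A_beta_def class_A_def \<phi>_def split: if_splits)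
  have "\<phi> holomorphic_on unit_disc"
    using quotient_by_id_holomorphic[OF f(1) open_ball f(2)] unfolding \<phi>_def .
  then obtain \<Phi> where \<Phi>: "\<And>z. z \<in> unit_disc \<Longrightarrow> (\<Phi> has_field_derivative \<phi> z) (at z)"
    using holomorphic_convex_primitive'[of unit_disc \<phi>]
    by (auto simp: at_within_open[OF _ open_ball])
  have F: "F z = (\<Phi> z - \<Phi> (x * z)) / (1 - x)"
    and F': "(F has_field_derivative (\<phi> z - x * \<phi> (x * z)) / (1 - x)) (at z)"
    if "z \<in> unit_disc" for z
    using diff_quot_integral_eq[OF f(1,2) assms(2,3) \<Phi>[unfolded \<phi>_def] that]
    unfolding F_def \<phi>_def by blast+
  have "F holomorphic_on unit_disc"
    using F' by (subst holomorphic_on_open) blast+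
  moreover have "F 0 = 0"
    using F[of 0] by simp
  moreover have F'0: "deriv F 0 = 1"
    using DERIV_imp_deriv[OF F'[of 0]] assms(3) f(3) by (simp add: \<phi>_def)
  ultimately have "F \<in> class_A"
    by (simp add: class_A_def)
  moreover have "Re (of_real \<beta> * (if z = 0 then 1 else F z / z) + of_real (1 - \<beta>) * deriv F z) > 0"
    if z: "z \<in> unit_disc" for z
  proof (cases "z = 0")
    case True
    then show ?thesis
      using F'0 by simp
  next
    case False
    define P where "P = (\<lambda>w. of_real \<beta> * \<Phi> w + of_real (1 - \<beta>) * f w)"
    have P': "(P has_field_derivative of_real \<beta> * \<phi> w + of_real (1 - \<beta>) * deriv f w) (at w)"
      if w: "w \<in> unit_disc" for w
      unfolding P_def using \<Phi>[OF w] holomorphic_derivI[OF f(1) open_ball w]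
      by (auto intro!: derivative_eq_intros)
    have ne: "z \<noteq> x * z"
      using False assms(3) by simp
    have "deriv F z = (\<phi> z - x * \<phi> (x * z)) / (1 - x)"
      using F'[OF z] by (rule DERIV_imp_deriv)
    also have "\<dots> = (f z - f (x * z)) / (z - x * z)"
    proof -
      have "\<phi> z - x * \<phi> (x * z) = (f z - f (x * z)) / z"
        using False f(2) by (simp add: \<phi>_def diff_divide_distrib)
      then show ?thesis
        by (simp add: algebra_simps)
    qed
    finally have d: "deriv F z = (f z - f (x * z)) / (z - x * z)" .
    have "F z / z = (\<Phi> z - \<Phi> (x * z)) / (z - x * z)"
      using F[OF z] by (simp add: algebra_simps)
    then have "of_real \<beta> * (F z / z) + of_real (1 - \<beta>) * deriv F z
                 = (P z - P (x * z)) / (z - x * z)"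
      unfolding d P_def by (simp add: add_divide_distrib[symmetric] algebra_simps)
    moreover have "Re ((P z - P (x * z)) / (z - x * z)) > 0"
      using Re_difference_quotient_pos[OF convex_ball z mult_in_unit_disc[OF assms(2) z] ne P' pos] .
    ultimately show ?thesis
      using False by simp
  qed
  ultimately show ?thesis
    unfolding class_A_beta_def F_def by blast
qed

end
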